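(* Let $A=(A_{jk})_{1\le j\le J,1\le k\le K}$ be a matrix with non-negative coefficients. Suppose that the functions $\beta_k:\mathbb{R}_+^J\to\mathbb{R}_+$, $1\le k\le K$, are continuous and non-decreasing, and that there exists a vector $z^{(0)}\in\mathbb{R}_+^K$ such that $$z^{(0)}\le \Phi(z^{(0)}),\qquad z^{(0)}\le \Phi(\Phi(z^{(0)})),\qquad \Phi(z^{(0)})<\infty$$ hold coordinate by coordinate, where $\Phi(z)=(\phi_k(Az))_{1\le k\le K}$. Then there exists at least one $z\in\mathbb{R}_+^K$ with $z=\Phi(z)$, and therefore there also exists at least one solution $u\in\mathbb{R}_+^J$ of the fixed point equation $$u_j=\sum_{k=1}^K A_{jk}\,\phi_k(u),\qquad 1\le j\le J.$$
   Context: $J,K\ge 1$ are integers (numbers of nodes and of classes of connections), $\mathbb{R}_+=[0,\infty)$. For each class $k\in\{1,\dots,K\}$ there are constants $p_k\ge 0$ with $p_1+\cdots+p_K=1$, $a_k\ge 0$, $r_k\in(0,1)$, and a function $\beta_k:\mathbb{R}_+^J\to\mathbb{R}_+$. Set $$\alpha_k=p_k\sqrt{\frac{2}{\pi}}\left(\prod_{n=1}^{\infty}\frac{1-r_k^{2n}}{1-r_k^{2n-1}}\right)\sqrt{a_k},\qquad \phi_k(u)=\frac{\alpha_k}{\sqrt{\beta_k(u)}},\quad u\in\mathbb{R}_+^J,$$ with the convention $\phi_k(u)=+\infty$ when $\beta_k(u)=0$. For $z\in\mathbb{R}_+^K$, $Az\in\mathbb{R}_+^J$ is the vector with coordinates $(Az)_j=\sum_{k}A_{jk}z_k$.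 "Non-decreasing" for a function of several variables means non-decreasing with respect to the coordinatewise partial order; inequalities between vectors are coordinatewise. *)

theory Defs
  imports "HOL-Analysis.Analysis"
begin

(* prodinf starts at index 0, so the n-th factor here is the (n+1)-st factor
   (1 - r^(2n)) / (1 - r^(2n-1)) of a product starting at n = 1. *)
definition alpha :: "real \<Rightarrow> real \<Rightarrow> real \<Rightarrow> real" where
  "alpha p a r =
     p * sqrt (2 / pi) * (\<Prod>n. (1 - r ^ (2 * n + 2)) / (1 - r ^ (2 * n + 1))) * sqrt a"

(* The case b u = 0 is explicit because ereal division would give 0 instead of
   infinity when alpha p a r = 0. *)
definition phi :: "real \<Rightarrow> real \<Rightarrow> real \<Rightarrow> (real ^ 'j \<Rightarrow> real) \<Rightarrow> real ^ 'j \<Rightarrow> ereal" where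
  "phi p a r b u = (if b u = 0 then \<infinity> else ereal (alpha p a r / sqrt (b u)))"

definition Phi ::
  "('k \<Rightarrow> real) \<Rightarrow> ('k \<Rightarrow> real) \<Rightarrow> ('k \<Rightarrow> real) \<Rightarrow> ('k \<Rightarrow> real ^ 'j \<Rightarrow> real) \<Rightarrow>
    real ^ 'k ^ 'j \<Rightarrow> real ^ 'k \<Rightarrow> ereal ^ 'k" where
  "Phi p a r \<beta> A z = (\<chi> k. phi (p k) (a k) (r k) (\<beta> k) (A *v z))"

definition ereal_vec :: "real ^ 'k \<Rightarrow> ereal ^ 'k" where
  "ereal_vec z = (\<chi> k. ereal (z $ k))"

(* Inverse of ereal_vec on vectors with finite coordinates; used only on such vectors. *)
definition real_vec :: "ereal ^ 'k \<Rightarrow> real ^ 'k" where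
  "real_vec x = (\<chi> k. real_of_ereal (x $ k))"

end

theory Submission
  imports Defs
begin

text \<open>On the box between z0 and its image, every \<open>\<beta> k\<close> is bounded below by its positive value at
  \<open>A *v z0\<close>, so the antitone map \<open>Phi\<close> is finite and continuous there; antitonicity together with the
  hypothesis on the second iterate makes the box invariant, and Brouwer's theorem applies.\<close>

lemma matrix_vector_mult_mono:
  fixes A :: "real ^ 'n ^ 'm"
  assumes "\<And>i j. 0 \<le> A $ i $ j" and "x \<le> y"
  shows "A *v x \<le> A *v y"
  using assms by (auto simp: less_eq_vec_def matrix_vector_mult_def intro!: sum_mono mult_left_mono)

text \<open>The order interval is the closed box \<open>cbox a b\<close>, hence compact and
  convex.\<close>

lemma brouwer_atLeastAtMost_vec:
  fixes a b :: "real ^ 'n" and f :: "real ^ 'n \<Rightarrow> real ^ 'n"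
  assumes "a \<le> b" and "continuous_on {a..b} f" and "f ` {a..b} \<subseteq> {a..b}"
  obtains x where "x \<in> {a..b}" and "f x = x"
proof -
  have "{a..b} \<noteq> {}"
    using assms(1) by simp
  moreover have "compact {a..b}" and "convex {a..b}"
    by (simp_all add: interval_cbox_cart)
  ultimately show thesis
    using brouwer[of "{a..b}" f] assms(2,3) that by blast
qed

theorem proposition2:
  fixes p a r :: "'k::finite \<Rightarrow> real"
    and \<beta> :: "'k \<Rightarrow> real ^ 'j::finite \<Rightarrow> real"
    and A :: "real ^ 'k ^ 'j"
    and z0 :: "real ^ 'k"
  assumes p_nonneg: "\<And>k. 0 \<le> p k"
    and p_sum: "(\<Sum>k\<in>UNIV. p k) = 1"
    and a_nonneg: "\<And>k. 0 \<le> a k"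
    and r_range: "\<And>k. r k \<in> {0<..<1}"
    and \<beta>_nonneg: "\<And>k u. 0 \<le> u \<Longrightarrow> 0 \<le> \<beta> k u"
    and A_nonneg: "\<And>j k. 0 \<le> A $ j $ k"
    and \<beta>_cont: "\<And>k. continuous_on {u. 0 \<le> u} (\<beta> k)"
    and \<beta>_mono: "\<And>k. mono_on {u. 0 \<le> u} (\<beta> k)"
    and z0_nonneg: "0 \<le> z0"
    and z0_le: "ereal_vec z0 \<le> Phi p a r \<beta> A z0"
    and z0_le2: "ereal_vec z0 \<le> Phi p a r \<beta> A (real_vec (Phi p a r \<beta> A z0))"
    and Phi_finite: "\<And>k. Phi p a r \<beta> A z0 $ k < \<infinity>"
  shows "(\<exists>z :: real ^ 'k. 0 \<le> z \<and> ereal_vec z = Phi p a r \<beta> A z) \<and>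
    (\<exists>u :: real ^ 'j. 0 \<le> u \<and>
      (\<forall>j. ereal (u $ j) =
        (\<Sum>k\<in>UNIV. ereal (A $ j $ k) * phi (p k) (a k) (r k) (\<beta> k) u)))"
proof -
  define c where "c k = alpha (p k) (a k) (r k)" for k
  \<comment> \<open>Real-valued counterpart of \<open>Phi\<close>, to which Brouwer applies. Where
    \<beta> vanishes it takes the value 0 (division by zero) instead of \<infinity>, so the two
    agree only away from such points.\<close>
  define f where "f = (\<lambda>z. \<chi> k. c k / sqrt (\<beta> k (A *v z)))"
  have Phi_f: "Phi p a r \<beta> A z = ereal_vec (f z)" if "\<And>k. \<beta> k (A *v z) \<noteq> 0" for z
    using that by (simp add: Phi_def phi_def ereal_vec_def f_def c_def)
  have mult_mono: "A *v x \<le> A *v y" if "x \<le> y" for x y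
    using matrix_vector_mult_mono[OF A_nonneg that] .
  have mult_nonneg: "0 \<le> A *v z" if "z0 \<le> z" for z
    using mult_mono[of 0 z] that z0_nonneg by simp
  \<comment> \<open>Monotonicity is available only on the nonnegative orthant; the bound
    \<open>z0 \<le> x\<close> keeps both images under \<open>A\<close> there.\<close>
  have \<beta>_le: "\<beta> k (A *v x) \<le> \<beta> k (A *v y)" if "z0 \<le> x" "x \<le> y" for k x y
    using that by (intro mono_onD[OF \<beta>_mono]) (auto intro: mult_mono mult_nonneg order_trans)
  have pos0: "0 < \<beta> k (A *v z0)" for k
  proof -
    \<comment> \<open>A zero of \<beta> would put \<open>phi\<close> in its infinite branch, against
      \<open>Phi_finite\<close>.\<close>
    have "\<beta> k (A *v z0) \<noteq> 0"
      using Phi_finite[of k] by (auto simp: Phi_def phi_def split: if_splits)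
    then show ?thesis
      using \<beta>_nonneg[OF mult_nonneg[OF order_refl], of k] by simp
  qed
  have pos: "0 < \<beta> k (A *v z)" if "z0 \<le> z" for k z
    using pos0[of k] \<beta>_le[OF order_refl that, of k] by linarith
  have Phi_eq: "Phi p a r \<beta> A z = ereal_vec (f z)" if "z0 \<le> z" for z
    using pos[OF that] by (intro Phi_f) (metis less_irrefl)
  have z0_le_f: "z0 \<le> f z0"
    using z0_le by (simp add: Phi_eq ereal_vec_def less_eq_vec_def)
  have "real_vec (Phi p a r \<beta> A z0) = f z0"
    by (simp add: Phi_eq ereal_vec_def real_vec_def)
  then have z0_le_ff: "z0 \<le> f (f z0)"
    using z0_le2 by (simp add: Phi_eq[OF z0_le_f] ereal_vec_def less_eq_vec_def)
  \<comment> \<open>Reading the sign off \<open>z0_le\<close> avoids proving convergence of the infinite product in \<open>alpha\<close>.\<close>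
  have c_nonneg: "0 \<le> c k" for k
  proof -
    have "0 \<le> c k / sqrt (\<beta> k (A *v z0))"
      using order_trans[OF z0_nonneg z0_le_f] by (simp add: f_def less_eq_vec_def)
    then show ?thesis
      using pos0[of k] by (simp add: zero_le_divide_iff not_le)
  qed
  have f_anti: "f y \<le> f x" if "z0 \<le> x" "x \<le> y" for x y
    using c_nonneg pos[OF that(1)] pos[OF order_trans[OF that]] \<beta>_le[OF that]
    by (auto simp: f_def less_eq_vec_def intro!: divide_left_mono mult_pos_pos)
  have "continuous_on {z0..f z0} (\<lambda>z. \<beta> k (A *v z))" for k
    by (rule continuous_on_compose2[OF \<beta>_cont])
      (auto intro: mult_nonneg linear_continuous_on matrix_vector_mul_bounded_linear)
  moreover have "sqrt (\<beta> k (A *v z)) \<noteq> 0" if "z \<in> {z0..f z0}" for k z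
    using pos[of z k] that by simp
  ultimately have "continuous_on {z0..f z0} f"
    unfolding f_def
    by (intro continuous_on_vec_lambda continuous_on_divide continuous_on_const
        continuous_on_real_sqrt) auto
  \<comment> \<open>For \<open>z0 \<le> z \<le> f z0\<close>, antitonicity gives
    \<open>f (f z0) \<le> f z \<le> f z0\<close>, and \<open>z0_le_ff\<close> bounds the left end
    below by \<open>z0\<close>.\<close>
  moreover have "f ` {z0..f z0} \<subseteq> {z0..f z0}"
    by (auto intro: f_anti order_trans[OF z0_le_ff f_anti])
  ultimately obtain z where z: "z \<in> {z0..f z0}" "f z = z"
    using brouwer_atLeastAtMost_vec[OF z0_le_f] by blast
  have fixed: "ereal_vec z = Phi p a r \<beta> A z"
    using z by (simp add: Phi_eq)
  then have "phi (p k) (a k) (r k) (\<beta> k) (A *v z) = ereal (z $ k)" for k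
    by (simp add: ereal_vec_def Phi_def vec_eq_iff)
  \<comment> \<open>The solution is \<open>u = A *v z\<close>: at the fixed point every
    \<open>phi\<close> value is the real \<open>z $ k\<close>, so the extended sum is a coordinate
    of the matrix product.\<close>
  then have "ereal ((A *v z) $ j) =
      (\<Sum>k\<in>UNIV. ereal (A $ j $ k) * phi (p k) (a k) (r k) (\<beta> k) (A *v z))" for j
    by (simp add: matrix_vector_mult_def)
  moreover have "0 \<le> z"
    using z z0_nonneg by auto
  ultimately show ?thesis
    using fixed mult_nonneg z by auto
qed

end
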